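(* Let $\mathcal C=(C,G,\delta)$ be a crossed module of groupoids, let $s\in FDer(\mathcal C)$ and let $f=(f_0,f_1,f_2)=\Delta(s)$. Then the following conditions are equivalent: (i) $s\in FDer^*(\mathcal C)$; (ii) $f_1\in\mathrm{Aut}(G)$; (iii) $f_2\in\mathrm{Aut}(C)$.
   Context: Conventions: the source and target maps of a groupoid are $\alpha,\beta$; composition is written additively, $a+b$ being defined when $\beta a=\alpha b$; $-a$ is the inverse of $a$; $G(x,y)$ is the set of $a\in G$ with $\alpha a=x$, $\beta a=y$. A groupoid is totally intransitive if $\alpha=\beta$. $\mathrm{Aut}(G)$, $\mathrm{Aut}(C)$ denote the groups of groupoid automorphisms (bijective on objects and on arrows); here $f_1$ and $f_2$ are regarded as groupoid morphisms with object map $f_0$. Action: if $G,C$ are groupoids over the same object set and $C$ is totally intransitive, an action of $G$ on $C$ is a partial function $(c,a)\mapsto c^a$, defined iff $\beta(c)=\alpha(a)$, with $\beta(c^a)=\beta(a)$, $(c_1+c_2)^a=c_1^a+c_2^a$, $c^{a+b}=(c^a)^b$, and $c^{e_x}=c$ for identities $e_x$. A crossed module of groupoids $\mathcal C=(C,G,\delta)$ consists of groupoids $C,G$ over the same object set $X$ with $C$ totally intransitive, a groupoid morphism $\delta:C\to G$ which is the identity on objects, and an action of $G$ on $C$ with $\delta(c^a)=-a+\delta c+a$ and $c^{\delta c_1}=-c_1+c+c_1$ for $c,c_1\in C(x,x)$, $a\in G(x,y)$. An endomorphism of $\mathcal C$ is a triple $f=(f_0,f_1,f_2)$ with $f_1:G\to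 G$, $f_2:C\to C$ groupoid morphisms having the same object map $f_0:X\to X$, such that $\delta f_2=f_1\delta$ and $f_2(c^a)=f_2(c)^{f_1(a)}$. A free derivation on $\mathcal C$ is a pair $s=(s_0,s_1)$ of functions $s_0:X\to G$, $s_1:G\to C$ such that $\beta(s_0x)=x$, $\beta(s_1a)=\beta a$, and $s_1(a+b)=s_1(a)^b+s_1(b)$ whenever $a+b$ is defined. $FDer(\mathcal C)$ is the set of free derivations. For a free derivation $s$, $\Delta(s)=f=(f_0,f_1,f_2)$ is the endomorphism of $\mathcal C$ given by $f_0(x)=\alpha s_0(x)$, $f_1(a)=s_0(\alpha a)+a+\delta s_1(a)-s_0(\beta a)$, $f_2(c)=(c+s_1\delta c)^{-s_0(\beta c)}$. $FDer(\mathcal C)$ is a monoid under $(s*t)_0(x)=s_0(g_0(x))+t_0(x)$ for $x\in X$, $(s*t)_1(a)=t_1(a)+(s_1(g_1(a)))^{t_0(\beta a)}$ for $a\in G$, where $g=\Delta(t)$; its identity is the pair with $s_0(x)$ the identity at $x$ and $s_1(a)$ the identity of $C$ at $\beta a$. $FDer^*(\mathcal C)$ is the group of invertible elements of this monoid. *)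

theory Defs
  imports "HOL-Algebra.Group"
begin

section \<open>Groupoids\<close>

text \<open>Composition is written additively and in diagrammatic order. The operations are total HOL
  functions whose values matter only on \<open>Obj G\<close>, on \<open>Arr G\<close> and, for composition, on pairs
  \<open>a\<close>, \<open>b\<close> with \<open>\<beta> a = \<alpha> b\<close>.\<close>

record ('x, 'a) groupoid =
  Obj :: "'x set"
  Arr :: "'a set"
  src :: "'a \<Rightarrow> 'x" ("\<alpha>\<index>")
  tgt :: "'a \<Rightarrow> 'x" ("\<beta>\<index>")
  gcomp :: "'a \<Rightarrow> 'a \<Rightarrow> 'a" (infixl "\<oplus>\<index>" 65)
  ident :: "'x \<Rightarrow> 'a" ("\<e>\<index>")
  gneg :: "'a \<Rightarrow> 'a" ("\<ominus>\<index> _" [81] 80)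

locale groupoid =
  fixes G :: "('x, 'a) groupoid" (structure)
  assumes src_closed: "a \<in> Arr G \<Longrightarrow> \<alpha> a \<in> Obj G"
    and tgt_closed: "a \<in> Arr G \<Longrightarrow> \<beta> a \<in> Obj G"
    and comp_closed: "\<lbrakk>a \<in> Arr G; b \<in> Arr G; \<beta> a = \<alpha> b\<rbrakk> \<Longrightarrow> a \<oplus> b \<in> Arr G"
    and src_comp: "\<lbrakk>a \<in> Arr G; b \<in> Arr G; \<beta> a = \<alpha> b\<rbrakk> \<Longrightarrow> \<alpha> (a \<oplus> b) = \<alpha> a"
    and tgt_comp: "\<lbrakk>a \<in> Arr G; b \<in> Arr G; \<beta> a = \<alpha> b\<rbrakk> \<Longrightarrow> \<beta> (a \<oplus> b) = \<beta> b"
    and comp_assoc: "\<lbrakk>a \<in> Arr G; b \<in> Arr G; c \<in> Arr G; \<beta> a = \<alpha> b; \<beta> b = \<alpha> c\<rbrakk>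
      \<Longrightarrow> (a \<oplus> b) \<oplus> c = a \<oplus> (b \<oplus> c)"
    and ident_closed: "x \<in> Obj G \<Longrightarrow> \<e> x \<in> Arr G"
    and src_ident: "x \<in> Obj G \<Longrightarrow> \<alpha> (\<e> x) = x"
    and tgt_ident: "x \<in> Obj G \<Longrightarrow> \<beta> (\<e> x) = x"
    and ident_left: "a \<in> Arr G \<Longrightarrow> \<e> (\<alpha> a) \<oplus> a = a"
    and ident_right: "a \<in> Arr G \<Longrightarrow> a \<oplus> \<e> (\<beta> a) = a"
    and neg_closed: "a \<in> Arr G \<Longrightarrow> \<ominus> a \<in> Arr G"
    and src_neg: "a \<in> Arr G \<Longrightarrow> \<alpha> (\<ominus> a) = \<beta> a"
    and tgt_neg: "a \<in> Arr G \<Longrightarrow> \<beta> (\<ominus> a) = \<alpha> a"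
    and neg_left: "a \<in> Arr G \<Longrightarrow> (\<ominus> a) \<oplus> a = \<e> (\<beta> a)"
    and neg_right: "a \<in> Arr G \<Longrightarrow> a \<oplus> (\<ominus> a) = \<e> (\<alpha> a)"

definition totally_intransitive :: "('x, 'a) groupoid \<Rightarrow> bool" where
  "totally_intransitive G \<longleftrightarrow> (\<forall>a\<in>Arr G. \<alpha>\<^bsub>G\<^esub> a = \<beta>\<^bsub>G\<^esub> a)"

text \<open>A morphism is a pair of an object map and an arrow map. Preservation of identities and
  inverses follows from preservation of composition.\<close>

definition groupoid_hom ::
    "('x, 'a) groupoid \<Rightarrow> ('y, 'b) groupoid \<Rightarrow> (('x \<Rightarrow> 'y) \<times> ('a \<Rightarrow> 'b)) set" where
  "groupoid_hom G H = {(h0, h1).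
     h0 \<in> Obj G \<rightarrow> Obj H \<and> h1 \<in> Arr G \<rightarrow> Arr H \<and>
     (\<forall>a\<in>Arr G. \<alpha>\<^bsub>H\<^esub> (h1 a) = h0 (\<alpha>\<^bsub>G\<^esub> a) \<and> \<beta>\<^bsub>H\<^esub> (h1 a) = h0 (\<beta>\<^bsub>G\<^esub> a)) \<and>
     (\<forall>a\<in>Arr G. \<forall>b\<in>Arr G. \<beta>\<^bsub>G\<^esub> a = \<alpha>\<^bsub>G\<^esub> b \<longrightarrow> h1 (a \<oplus>\<^bsub>G\<^esub> b) = h1 a \<oplus>\<^bsub>H\<^esub> h1 b)}"

text \<open>As in \<^const>\<open>extensional\<close>-based function spaces, maps with domain the objects or arrows
  are normalised to be \<^const>\<open>undefined\<close> outside, so that equality of maps is equality in HOL.\<close>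

definition groupoid_Aut :: "('x, 'a) groupoid \<Rightarrow> (('x \<Rightarrow> 'x) \<times> ('a \<Rightarrow> 'a)) set" where
  "groupoid_Aut G = {(h0, h1) \<in> groupoid_hom G G.
     h0 \<in> extensional (Obj G) \<and> h1 \<in> extensional (Arr G) \<and>
     bij_betw h0 (Obj G) (Obj G) \<and> bij_betw h1 (Arr G) (Arr G)}"


section \<open>Crossed modules of groupoids\<close>

text \<open>\<open>act c a\<close> stands for \<open>c\<^sup>a\<close>; it is relevant only when \<open>\<beta> c = \<alpha> a\<close>.\<close>

definition groupoid_action ::
    "('x, 'g) groupoid \<Rightarrow> ('x, 'c) groupoid \<Rightarrow> ('c \<Rightarrow> 'g \<Rightarrow> 'c) \<Rightarrow> bool" where
  "groupoid_action G C act \<longleftrightarrow>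
     (\<forall>c\<in>Arr C. \<forall>a\<in>Arr G. \<beta>\<^bsub>C\<^esub> c = \<alpha>\<^bsub>G\<^esub> a \<longrightarrow>
        act c a \<in> Arr C \<and> \<beta>\<^bsub>C\<^esub> (act c a) = \<beta>\<^bsub>G\<^esub> a) \<and>
     (\<forall>c\<in>Arr C. \<forall>d\<in>Arr C. \<forall>a\<in>Arr G. \<beta>\<^bsub>C\<^esub> c = \<alpha>\<^bsub>C\<^esub> d \<and> \<beta>\<^bsub>C\<^esub> d = \<alpha>\<^bsub>G\<^esub> a \<longrightarrow>
        act (c \<oplus>\<^bsub>C\<^esub> d) a = act c a \<oplus>\<^bsub>C\<^esub> act d a) \<and>
     (\<forall>c\<in>Arr C. \<forall>a\<in>Arr G. \<forall>b\<in>Arr G. \<beta>\<^bsub>C\<^esub> c = \<alpha>\<^bsub>G\<^esub> a \<and> \<beta>\<^bsub>G\<^esub> a = \<alpha>\<^bsub>G\<^esub> b \<longrightarrow>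
        act c (a \<oplus>\<^bsub>G\<^esub> b) = act (act c a) b) \<and>
     (\<forall>c\<in>Arr C. act c (\<e>\<^bsub>G\<^esub> (\<beta>\<^bsub>C\<^esub> c)) = c)"

record ('x, 'g, 'c) crossed_module =
  Cgd :: "('x, 'c) groupoid"
  Ggd :: "('x, 'g) groupoid"
  bdry :: "'c \<Rightarrow> 'g"
  act :: "'c \<Rightarrow> 'g \<Rightarrow> 'c"

locale crossed_module =
  fixes M :: "('x, 'g, 'c) crossed_module"
  assumes groupoid_C: "groupoid (Cgd M)"
    and groupoid_G: "groupoid (Ggd M)"
    and same_objects: "Obj (Cgd M) = Obj (Ggd M)"
    and C_totally_intransitive: "totally_intransitive (Cgd M)"
    and bdry_hom: "(id, bdry M) \<in> groupoid_hom (Cgd M) (Ggd M)"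
    and action: "groupoid_action (Ggd M) (Cgd M) (act M)"
    and bdry_act: "\<lbrakk>c \<in> Arr (Cgd M); a \<in> Arr (Ggd M); \<beta>\<^bsub>Cgd M\<^esub> c = \<alpha>\<^bsub>Ggd M\<^esub> a\<rbrakk>
      \<Longrightarrow> bdry M (act M c a) = (\<ominus>\<^bsub>Ggd M\<^esub> a) \<oplus>\<^bsub>Ggd M\<^esub> bdry M c \<oplus>\<^bsub>Ggd M\<^esub> a"
    and act_bdry: "\<lbrakk>c \<in> Arr (Cgd M); d \<in> Arr (Cgd M); \<beta>\<^bsub>Cgd M\<^esub> c = \<beta>\<^bsub>Cgd M\<^esub> d\<rbrakk>
      \<Longrightarrow> act M c (bdry M d) = (\<ominus>\<^bsub>Cgd M\<^esub> d) \<oplus>\<^bsub>Cgd M\<^esub> c \<oplus>\<^bsub>Cgd M\<^esub> d"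


section \<open>Free derivations\<close>

definition FDer ::
    "('x, 'g, 'c) crossed_module \<Rightarrow> (('x \<Rightarrow> 'g) \<times> ('g \<Rightarrow> 'c)) set" where
  "FDer M = {(s0, s1).
     s0 \<in> Obj (Ggd M) \<rightarrow>\<^sub>E Arr (Ggd M) \<and> s1 \<in> Arr (Ggd M) \<rightarrow>\<^sub>E Arr (Cgd M) \<and>
     (\<forall>x\<in>Obj (Ggd M). \<beta>\<^bsub>Ggd M\<^esub> (s0 x) = x) \<and>
     (\<forall>a\<in>Arr (Ggd M). \<beta>\<^bsub>Cgd M\<^esub> (s1 a) = \<beta>\<^bsub>Ggd M\<^esub> a) \<and>
     (\<forall>a\<in>Arr (Ggd M). \<forall>b\<in>Arr (Ggd M). \<beta>\<^bsub>Ggd M\<^esub> a = \<alpha>\<^bsub>Ggd M\<^esub> b \<longrightarrow>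
        s1 (a \<oplus>\<^bsub>Ggd M\<^esub> b) = act M (s1 a) b \<oplus>\<^bsub>Cgd M\<^esub> s1 b)}"

definition Delta ::
    "('x, 'g, 'c) crossed_module \<Rightarrow> ('x \<Rightarrow> 'g) \<times> ('g \<Rightarrow> 'c) \<Rightarrow>
      ('x \<Rightarrow> 'x) \<times> ('g \<Rightarrow> 'g) \<times> ('c \<Rightarrow> 'c)" where
  "Delta M = (\<lambda>(s0, s1).
     (\<lambda>x\<in>Obj (Ggd M). \<alpha>\<^bsub>Ggd M\<^esub> (s0 x),
      \<lambda>a\<in>Arr (Ggd M). s0 (\<alpha>\<^bsub>Ggd M\<^esub> a) \<oplus>\<^bsub>Ggd M\<^esub> a \<oplus>\<^bsub>Ggd M\<^esub> bdry M (s1 a)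
        \<oplus>\<^bsub>Ggd M\<^esub> (\<ominus>\<^bsub>Ggd M\<^esub> s0 (\<beta>\<^bsub>Ggd M\<^esub> a)),
      \<lambda>c\<in>Arr (Cgd M). act M (c \<oplus>\<^bsub>Cgd M\<^esub> s1 (bdry M c)) (\<ominus>\<^bsub>Ggd M\<^esub> s0 (\<beta>\<^bsub>Cgd M\<^esub> c))))"

definition FDer_mult ::
    "('x, 'g, 'c) crossed_module \<Rightarrow> ('x \<Rightarrow> 'g) \<times> ('g \<Rightarrow> 'c) \<Rightarrow> ('x \<Rightarrow> 'g) \<times> ('g \<Rightarrow> 'c) \<Rightarrow>
      ('x \<Rightarrow> 'g) \<times> ('g \<Rightarrow> 'c)" where
  "FDer_mult M = (\<lambda>(s0, s1) (t0, t1). case Delta M (t0, t1) of (g0, g1, g2) \<Rightarrow>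
     (\<lambda>x\<in>Obj (Ggd M). s0 (g0 x) \<oplus>\<^bsub>Ggd M\<^esub> t0 x,
      \<lambda>a\<in>Arr (Ggd M). t1 a \<oplus>\<^bsub>Cgd M\<^esub> act M (s1 (g1 a)) (t0 (\<beta>\<^bsub>Ggd M\<^esub> a))))"

definition FDer_one :: "('x, 'g, 'c) crossed_module \<Rightarrow> ('x \<Rightarrow> 'g) \<times> ('g \<Rightarrow> 'c)" where
  "FDer_one M =
     (\<lambda>x\<in>Obj (Ggd M). \<e>\<^bsub>Ggd M\<^esub> x, \<lambda>a\<in>Arr (Ggd M). \<e>\<^bsub>Cgd M\<^esub> (\<beta>\<^bsub>Ggd M\<^esub> a))"

definition FDer_monoid ::
    "('x, 'g, 'c) crossed_module \<Rightarrow> (('x \<Rightarrow> 'g) \<times> ('g \<Rightarrow> 'c)) monoid" where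
  "FDer_monoid M = \<lparr>carrier = FDer M, mult = FDer_mult M, one = FDer_one M\<rparr>"

definition FDer_star :: "('x, 'g, 'c) crossed_module \<Rightarrow> (('x \<Rightarrow> 'g) \<times> ('g \<Rightarrow> 'c)) set" where
  "FDer_star M = Units (FDer_monoid M)"

end

theory Submission
  imports Defs
begin

text \<open>If \<open>h\<close> inverts \<open>f\<close> on \<open>G\<close>, then \<open>s\<close> has the inverse \<open>t\<^sub>0 x = -s\<^sub>0(h\<^sub>0 x)\<close>,
  \<open>t\<^sub>1 a = -s\<^sub>1(h\<^sub>1 a)\<^bsup>t\<^sub>0(\<beta> a)\<^esup>\<close>; conversely \<open>\<Delta>\<close> is multiplicative, so an invertible \<open>s\<close> gives
  bijective \<open>f\<^sub>1\<close> and \<open>f\<^sub>2\<close>. If only \<open>f\<^sub>0\<close> and \<open>f\<^sub>2\<close> are known to be bijective, then \<open>f\<^sub>1\<close> is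
  injective because \<open>f\<^sub>1 k = 0\<close> forces \<open>k = \<delta> (-s\<^sub>1 k)\<close> with \<open>f\<^sub>2 (-s\<^sub>1 k) = 0\<close>, and surjective
  because \<open>f\<^sub>1 (-s\<^sub>0 x + b + s\<^sub>0 y)\<close> differs from \<open>b\<close> by an element of
  \<open>\<delta> C = \<delta> f\<^sub>2 C = f\<^sub>1 \<delta> C\<close>.\<close>

section \<open>Word calculus in a groupoid\<close>

context groupoid
begin

lemmas groupoid_simps [simp] =
  src_closed tgt_closed comp_closed src_comp tgt_comp comp_assoc ident_closed src_ident tgt_ident
  neg_closed src_neg tgt_neg neg_left neg_right

lemma ident_comp [simp]: "\<lbrakk>a \<in> Arr G; \<alpha> a = x\<rbrakk> \<Longrightarrow> \<e> x \<oplus> a = a"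
  using ident_left by blast

lemma comp_ident [simp]: "\<lbrakk>a \<in> Arr G; \<beta> a = x\<rbrakk> \<Longrightarrow> a \<oplus> \<e> x = a"
  using ident_right by blast

text \<open>Since \<open>comp_assoc\<close> reassociates to the right, an arrow meets its inverse in
  front of a tail. With the rules for negated sums this gives normal forms for words, on which most
  later calculations rest.\<close>

lemma neg_comp_cancel [simp]:
  "\<lbrakk>a \<in> Arr G; b \<in> Arr G; \<beta> a = \<alpha> b\<rbrakk> \<Longrightarrow> \<ominus> a \<oplus> (a \<oplus> b) = b"
  by (simp flip: comp_assoc)

lemma comp_neg_cancel [simp]:
  "\<lbrakk>a \<in> Arr G; b \<in> Arr G; \<alpha> a = \<alpha> b\<rbrakk> \<Longrightarrow> a \<oplus> (\<ominus> a \<oplus> b) = b"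
  by (simp flip: comp_assoc)

lemma neg_unique:
  assumes "a \<in> Arr G" "b \<in> Arr G" "\<beta> a = \<alpha> b" "a \<oplus> b = \<e> (\<alpha> a)"
  shows "\<ominus> a = b"
  using neg_comp_cancel[OF assms(1-3)] assms by simp

lemma neg_neg [simp]: "a \<in> Arr G \<Longrightarrow> \<ominus> (\<ominus> a) = a"
  by (rule neg_unique) auto

lemma neg_ident [simp]: "x \<in> Obj G \<Longrightarrow> \<ominus> (\<e> x) = \<e> x"
  by (rule neg_unique) auto

lemma neg_comp [simp]:
  "\<lbrakk>a \<in> Arr G; b \<in> Arr G; \<beta> a = \<alpha> b\<rbrakk> \<Longrightarrow> \<ominus> (a \<oplus> b) = \<ominus> b \<oplus> \<ominus> a"
  by (rule neg_unique) auto

text \<open>A map that preserves composition sends an identity to an idempotent loop; this is how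
  \<open>\<delta>\<close>, the action, \<open>f1\<close> and \<open>f2\<close> are shown to preserve
  identities.\<close>

lemma idempotent_eq_ident:
  assumes "a \<in> Arr G" "\<alpha> a = \<beta> a" "a \<oplus> a = a"
  shows "a = \<e> (\<beta> a)"
  using neg_comp_cancel[of a a] assms by simp

lemma diff_eq_ident:
  assumes "a \<in> Arr G" "b \<in> Arr G" "\<beta> a = \<beta> b" "a \<oplus> \<ominus> b = \<e> (\<alpha> b)"
  shows "a = b"
proof -
  have "a = (a \<oplus> \<ominus> b) \<oplus> b"
    using assms(1-3) by simp
  then show ?thesis
    using assms by simp
qed

end

section \<open>Calculus of boundaries and actions\<close>

context crossed_module
begin

sublocale G: groupoid "Ggd M" by (rule groupoid_G)
sublocale C: groupoid "Cgd M" by (rule groupoid_C)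

abbreviation G where "G \<equiv> Ggd M"
abbreviation C where "C \<equiv> Cgd M"
abbreviation \<delta> where "\<delta> \<equiv> bdry M"
abbreviation action_op (infixl "\<triangleright>" 90) where "c \<triangleright> a \<equiv> act M c a"

lemma Obj_C [simp]: "Obj C = Obj G"
  by (rule same_objects)

lemma src_C [simp]: "c \<in> Arr C \<Longrightarrow> \<alpha>\<^bsub>C\<^esub> c = \<beta>\<^bsub>C\<^esub> c"
  using C_totally_intransitive by (simp add: totally_intransitive_def)

lemma tgt_C_closed [simp]: "c \<in> Arr C \<Longrightarrow> \<beta>\<^bsub>C\<^esub> c \<in> Obj G"
  using C.tgt_closed by simp

lemma bdry_simps [simp]:
  shows bdry_closed: "c \<in> Arr C \<Longrightarrow> \<delta> c \<in> Arr G"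
    and src_bdry: "c \<in> Arr C \<Longrightarrow> \<alpha>\<^bsub>G\<^esub> (\<delta> c) = \<beta>\<^bsub>C\<^esub> c"
    and tgt_bdry: "c \<in> Arr C \<Longrightarrow> \<beta>\<^bsub>G\<^esub> (\<delta> c) = \<beta>\<^bsub>C\<^esub> c"
    and bdry_comp: "\<lbrakk>c \<in> Arr C; d \<in> Arr C; \<beta>\<^bsub>C\<^esub> c = \<beta>\<^bsub>C\<^esub> d\<rbrakk>
      \<Longrightarrow> \<delta> (c \<oplus>\<^bsub>C\<^esub> d) = \<delta> c \<oplus>\<^bsub>G\<^esub> \<delta> d"
  using bdry_hom by (auto simp: groupoid_hom_def)

lemma bdry_ident [simp]: "x \<in> Obj G \<Longrightarrow> \<delta> (\<e>\<^bsub>C\<^esub> x) = \<e>\<^bsub>G\<^esub> x"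
  using G.idempotent_eq_ident[of "\<delta> (\<e>\<^bsub>C\<^esub> x)"] bdry_comp[of "\<e>\<^bsub>C\<^esub> x" "\<e>\<^bsub>C\<^esub> x"] by simp

lemma bdry_neg [simp]: "c \<in> Arr C \<Longrightarrow> \<delta> (\<ominus>\<^bsub>C\<^esub> c) = \<ominus>\<^bsub>G\<^esub> \<delta> c"
  by (rule G.neg_unique[symmetric]) (simp_all flip: bdry_comp)

lemma act_simps [simp]:
  shows act_closed: "\<lbrakk>c \<in> Arr C; a \<in> Arr G; \<beta>\<^bsub>C\<^esub> c = \<alpha>\<^bsub>G\<^esub> a\<rbrakk> \<Longrightarrow> c \<triangleright> a \<in> Arr C"
    and tgt_act: "\<lbrakk>c \<in> Arr C; a \<in> Arr G; \<beta>\<^bsub>C\<^esub> c = \<alpha>\<^bsub>G\<^esub> a\<rbrakk> \<Longrightarrow> \<beta>\<^bsub>C\<^esub> (c \<triangleright> a) = \<beta>\<^bsub>G\<^esub> a"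
    and comp_act: "\<lbrakk>c \<in> Arr C; d \<in> Arr C; a \<in> Arr G; \<beta>\<^bsub>C\<^esub> c = \<beta>\<^bsub>C\<^esub> d; \<beta>\<^bsub>C\<^esub> d = \<alpha>\<^bsub>G\<^esub> a\<rbrakk>
      \<Longrightarrow> (c \<oplus>\<^bsub>C\<^esub> d) \<triangleright> a = c \<triangleright> a \<oplus>\<^bsub>C\<^esub> d \<triangleright> a"
    and act_comp: "\<lbrakk>c \<in> Arr C; a \<in> Arr G; b \<in> Arr G; \<beta>\<^bsub>C\<^esub> c = \<alpha>\<^bsub>G\<^esub> a; \<beta>\<^bsub>G\<^esub> a = \<alpha>\<^bsub>G\<^esub> b\<rbrakk>
      \<Longrightarrow> c \<triangleright> (a \<oplus>\<^bsub>G\<^esub> b) = c \<triangleright> a \<triangleright> b"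
    and act_ident: "\<lbrakk>c \<in> Arr C; \<beta>\<^bsub>C\<^esub> c = x\<rbrakk> \<Longrightarrow> c \<triangleright> \<e>\<^bsub>G\<^esub> x = c"
  using action by (auto simp: groupoid_action_def)

lemmas [simp] = bdry_act act_bdry

text \<open>\<open>bdry_neg\<close> pulls negation out of \<open>\<delta>\<close>, so
  \<open>act_bdry\<close> no longer matches inverses of boundaries; this rule covers them.\<close>

lemma act_neg_bdry [simp]:
  "\<lbrakk>c \<in> Arr C; d \<in> Arr C; \<beta>\<^bsub>C\<^esub> c = \<beta>\<^bsub>C\<^esub> d\<rbrakk>
    \<Longrightarrow> c \<triangleright> (\<ominus>\<^bsub>G\<^esub> \<delta> d) = d \<oplus>\<^bsub>C\<^esub> (c \<oplus>\<^bsub>C\<^esub> \<ominus>\<^bsub>C\<^esub> d)"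
  by (simp flip: bdry_neg)

lemma act_cancel [simp]:
  "\<lbrakk>c \<in> Arr C; a \<in> Arr G; \<beta>\<^bsub>C\<^esub> c = \<alpha>\<^bsub>G\<^esub> a\<rbrakk> \<Longrightarrow> c \<triangleright> a \<triangleright> (\<ominus>\<^bsub>G\<^esub> a) = c"
  "\<lbrakk>c \<in> Arr C; a \<in> Arr G; \<beta>\<^bsub>C\<^esub> c = \<beta>\<^bsub>G\<^esub> a\<rbrakk> \<Longrightarrow> c \<triangleright> (\<ominus>\<^bsub>G\<^esub> a) \<triangleright> a = c"
  by (simp_all flip: act_comp)

lemma ident_act [simp]:
  assumes "a \<in> Arr G" "\<alpha>\<^bsub>G\<^esub> a = x"
  shows "\<e>\<^bsub>C\<^esub> x \<triangleright> a = \<e>\<^bsub>C\<^esub> (\<beta>\<^bsub>G\<^esub> a)"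
proof -
  have "x \<in> Obj G"
    using assms by auto
  then show ?thesis
    using assms comp_act[of "\<e>\<^bsub>C\<^esub> x" "\<e>\<^bsub>C\<^esub> x" a]
      C.idempotent_eq_ident[of "\<e>\<^bsub>C\<^esub> x \<triangleright> a"] by simp
qed

lemma neg_act [simp]:
  assumes "c \<in> Arr C" "a \<in> Arr G" "\<beta>\<^bsub>C\<^esub> c = \<alpha>\<^bsub>G\<^esub> a"
  shows "(\<ominus>\<^bsub>C\<^esub> c) \<triangleright> a = \<ominus>\<^bsub>C\<^esub> (c \<triangleright> a)"
  by (rule C.neg_unique[symmetric]) (use assms in \<open>simp_all flip: comp_act\<close>)

end

section \<open>The endomorphism induced by a free derivation\<close>

locale free_derivation = crossed_module M
  for M :: "('x, 'g, 'c) crossed_module" +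
  fixes s0 :: "'x \<Rightarrow> 'g" and s1 :: "'g \<Rightarrow> 'c"
  assumes FDer: "(s0, s1) \<in> FDer M"
begin

lemma derivation_simps [simp]:
  shows s0_closed: "x \<in> Obj G \<Longrightarrow> s0 x \<in> Arr G"
    and tgt_s0: "x \<in> Obj G \<Longrightarrow> \<beta>\<^bsub>G\<^esub> (s0 x) = x"
    and s1_closed: "a \<in> Arr G \<Longrightarrow> s1 a \<in> Arr C"
    and tgt_s1: "a \<in> Arr G \<Longrightarrow> \<beta>\<^bsub>C\<^esub> (s1 a) = \<beta>\<^bsub>G\<^esub> a"
    and s1_comp: "\<lbrakk>a \<in> Arr G; b \<in> Arr G; \<beta>\<^bsub>G\<^esub> a = \<alpha>\<^bsub>G\<^esub> b\<rbrakk>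
      \<Longrightarrow> s1 (a \<oplus>\<^bsub>G\<^esub> b) = s1 a \<triangleright> b \<oplus>\<^bsub>C\<^esub> s1 b"
  using FDer by (auto simp: FDer_def)

definition f0 where "f0 = fst (Delta M (s0, s1))"
definition f1 where "f1 = fst (snd (Delta M (s0, s1)))"
definition f2 where "f2 = snd (snd (Delta M (s0, s1)))"

lemma Delta_eq: "Delta M (s0, s1) = (f0, f1, f2)"
  by (simp add: f0_def f1_def f2_def)

lemma f0_apply: "x \<in> Obj G \<Longrightarrow> f0 x = \<alpha>\<^bsub>G\<^esub> (s0 x)"
  by (simp add: f0_def Delta_def)

lemma f1_apply:
  "a \<in> Arr G \<Longrightarrow> f1 a = s0 (\<alpha>\<^bsub>G\<^esub> a) \<oplus>\<^bsub>G\<^esub> (a \<oplus>\<^bsub>G\<^esub> (\<delta> (s1 a) \<oplus>\<^bsub>G\<^esub> \<ominus>\<^bsub>G\<^esub> s0 (\<beta>\<^bsub>G\<^esub> a)))"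
  by (simp add: f1_def Delta_def)

lemma f2_apply:
  "c \<in> Arr C \<Longrightarrow> f2 c = (c \<oplus>\<^bsub>C\<^esub> s1 (\<delta> c)) \<triangleright> (\<ominus>\<^bsub>G\<^esub> s0 (\<beta>\<^bsub>C\<^esub> c))"
  by (simp add: f2_def Delta_def)

lemma src_s0 [simp]: "x \<in> Obj G \<Longrightarrow> \<alpha>\<^bsub>G\<^esub> (s0 x) = f0 x"
  by (simp add: f0_apply)

lemma f_extensional:
  "f0 \<in> extensional (Obj G)" "f1 \<in> extensional (Arr G)" "f2 \<in> extensional (Arr C)"
  by (simp_all add: f0_def f1_def f2_def Delta_def)

lemma f_simps [simp]:
  shows f0_closed: "x \<in> Obj G \<Longrightarrow> f0 x \<in> Obj G"
    and f1_closed: "a \<in> Arr G \<Longrightarrow> f1 a \<in> Arr G"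
    and src_f1: "a \<in> Arr G \<Longrightarrow> \<alpha>\<^bsub>G\<^esub> (f1 a) = f0 (\<alpha>\<^bsub>G\<^esub> a)"
    and tgt_f1: "a \<in> Arr G \<Longrightarrow> \<beta>\<^bsub>G\<^esub> (f1 a) = f0 (\<beta>\<^bsub>G\<^esub> a)"
    and f2_closed: "c \<in> Arr C \<Longrightarrow> f2 c \<in> Arr C"
    and tgt_f2: "c \<in> Arr C \<Longrightarrow> \<beta>\<^bsub>C\<^esub> (f2 c) = f0 (\<beta>\<^bsub>C\<^esub> c)"
  by (simp_all add: f1_apply f2_apply flip: src_s0)

text \<open>The derivation law gives \<open>\<delta> (s1 (a + b)) = -b + \<delta> (s1 a) + b +
  \<delta> (s1 b)\<close>, which moves \<open>\<delta> (s1 a)\<close> in front of \<open>b\<close>;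
  the inner \<open>s0\<close> terms cancel.\<close>

lemma f1_comp:
  "\<lbrakk>a \<in> Arr G; b \<in> Arr G; \<beta>\<^bsub>G\<^esub> a = \<alpha>\<^bsub>G\<^esub> b\<rbrakk> \<Longrightarrow> f1 (a \<oplus>\<^bsub>G\<^esub> b) = f1 a \<oplus>\<^bsub>G\<^esub> f1 b"
  by (simp add: f1_apply)

text \<open>Here \<open>s1 (\<delta> c)\<close> is acted on by \<open>\<delta> d\<close>, that is,
  conjugated by \<open>d\<close>, so the sum rearranges to
  \<open>c + s1 (\<delta> c) + d + s1 (\<delta> d)\<close>.\<close>

lemma f2_comp:
  "\<lbrakk>c \<in> Arr C; d \<in> Arr C; \<beta>\<^bsub>C\<^esub> c = \<beta>\<^bsub>C\<^esub> d\<rbrakk> \<Longrightarrow> f2 (c \<oplus>\<^bsub>C\<^esub> d) = f2 c \<oplus>\<^bsub>C\<^esub> f2 d"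
  by (simp add: f2_apply)

lemma bdry_f2: "c \<in> Arr C \<Longrightarrow> \<delta> (f2 c) = f1 (\<delta> c)"
  by (simp add: f1_apply f2_apply)

lemma f1_hom: "(f0, f1) \<in> groupoid_hom G G"
  by (auto simp: groupoid_hom_def f1_comp)

lemma f2_hom: "(f0, f2) \<in> groupoid_hom C C"
  by (auto simp: groupoid_hom_def f2_comp)

lemma f1_Aut_iff:
  "(f0, f1) \<in> groupoid_Aut G \<longleftrightarrow> bij_betw f0 (Obj G) (Obj G) \<and> bij_betw f1 (Arr G) (Arr G)"
  by (simp add: groupoid_Aut_def f1_hom f_extensional)

lemma f2_Aut_iff:
  "(f0, f2) \<in> groupoid_Aut C \<longleftrightarrow> bij_betw f0 (Obj G) (Obj G) \<and> bij_betw f2 (Arr C) (Arr C)"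
  by (simp add: groupoid_Aut_def f2_hom f_extensional)

section \<open>Bijectivity of the arrow map on G from that on C\<close>

lemma f1_neg: "a \<in> Arr G \<Longrightarrow> f1 (\<ominus>\<^bsub>G\<^esub> a) = \<ominus>\<^bsub>G\<^esub> f1 a"
proof -
  assume a: "a \<in> Arr G"
  have ident: "f1 (\<e>\<^bsub>G\<^esub> x) = \<e>\<^bsub>G\<^esub> (f0 x)" if "x \<in> Obj G" for x
    using that f1_comp[of "\<e>\<^bsub>G\<^esub> x" "\<e>\<^bsub>G\<^esub> x"] G.idempotent_eq_ident[of "f1 (\<e>\<^bsub>G\<^esub> x)"] by simp
  show ?thesis
    by (rule G.neg_unique[symmetric]) (use a in \<open>simp_all add: ident flip: f1_comp\<close>)
qed

lemma f2_ident: "x \<in> Obj G \<Longrightarrow> f2 (\<e>\<^bsub>C\<^esub> x) = \<e>\<^bsub>C\<^esub> (f0 x)"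
  using f2_comp[of "\<e>\<^bsub>C\<^esub> x" "\<e>\<^bsub>C\<^esub> x"] C.idempotent_eq_ident[of "f2 (\<e>\<^bsub>C\<^esub> x)"] by simp

text \<open>Injectivity of \<open>f0\<close> makes arrows with equal images parallel, so only loops
  \<open>k\<close> with trivial image have to be treated.\<close>

lemma inj_on_f1:
  assumes "inj_on f0 (Obj G)" "inj_on f2 (Arr C)"
  shows "inj_on f1 (Arr G)"
proof (rule inj_onI)
  fix a b assume ab: "a \<in> Arr G" "b \<in> Arr G" and eq: "f1 a = f1 b"
  have src: "\<alpha>\<^bsub>G\<^esub> a = \<alpha>\<^bsub>G\<^esub> b"
    using assms(1) ab by (metis eq inj_onD src_f1 G.src_closed)
  have tgt: "\<beta>\<^bsub>G\<^esub> a = \<beta>\<^bsub>G\<^esub> b"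
    using assms(1) ab by (metis eq inj_onD tgt_f1 G.tgt_closed)
  define x where "x = \<alpha>\<^bsub>G\<^esub> b"
  define k where "k = a \<oplus>\<^bsub>G\<^esub> \<ominus>\<^bsub>G\<^esub> b"
  have x: "x \<in> Obj G" and k: "k \<in> Arr G" "\<alpha>\<^bsub>G\<^esub> k = x" "\<beta>\<^bsub>G\<^esub> k = x"
    using ab src tgt by (simp_all add: x_def k_def)
  have "f1 k = \<e>\<^bsub>G\<^esub> (f0 x)"
    using ab src tgt eq by (simp add: k_def x_def f1_comp f1_neg)
  \<comment> \<open>Conjugation by \<open>s0 x\<close> strips the outer terms of
    \<open>f1 k\<close>.\<close>
  then have "\<ominus>\<^bsub>G\<^esub> s0 x \<oplus>\<^bsub>G\<^esub> (f1 k \<oplus>\<^bsub>G\<^esub> s0 x) = \<e>\<^bsub>G\<^esub> x"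
    using x by simp
  then have "k \<oplus>\<^bsub>G\<^esub> \<delta> (s1 k) = \<e>\<^bsub>G\<^esub> x"
    using x k by (simp add: f1_apply)
  then have k_eq: "k = \<delta> (\<ominus>\<^bsub>C\<^esub> s1 k)"
    using x k G.neg_unique[of k "\<delta> (s1 k)"] G.neg_neg[of k] by simp
  \<comment> \<open>For \<open>c = -s1 k\<close> the sum \<open>c + s1 (\<delta> c)\<close> in
    \<open>f2 c\<close> is \<open>-s1 k + s1 k\<close>. Dropping \<open>bdry_neg\<close> keeps
    \<open>\<delta> c\<close> intact, so that it can be folded back to \<open>k\<close>.\<close>
  moreover have "f2 (\<ominus>\<^bsub>C\<^esub> s1 k) = f2 (\<e>\<^bsub>C\<^esub> x)"
    using x k f2_apply[of "\<ominus>\<^bsub>C\<^esub> s1 k"] by (simp add: f2_ident flip: k_eq del: bdry_neg)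
  then have "\<ominus>\<^bsub>C\<^esub> s1 k = \<e>\<^bsub>C\<^esub> x"
    using assms(2) x k by (auto dest: inj_onD)
  ultimately have "k = \<e>\<^bsub>G\<^esub> x"
    using x by (metis bdry_ident)
  then show "a = b"
    using G.diff_eq_ident ab tgt by (simp add: k_def x_def)
qed

lemma surj_f1:
  assumes f0: "bij_betw f0 (Obj G) (Obj G)" and f2: "f2 ` Arr C = Arr C" and b: "b \<in> Arr G"
  shows "b \<in> f1 ` Arr G"
proof -
  have "\<alpha>\<^bsub>G\<^esub> b \<in> f0 ` Obj G" "\<beta>\<^bsub>G\<^esub> b \<in> f0 ` Obj G"
    using f0 b by (simp_all add: bij_betw_def)
  then obtain x y where x: "x \<in> Obj G" "f0 x = \<alpha>\<^bsub>G\<^esub> b" and y: "y \<in> Obj G" "f0 y = \<beta>\<^bsub>G\<^esub> b"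
    unfolding image_iff by metis
  \<comment> \<open>Chosen so that \<open>s0 x + a - s0 y = b\<close>; only the boundary term of
    \<open>f1 a\<close> then separates it from \<open>b\<close>.\<close>
  define a where "a = \<ominus>\<^bsub>G\<^esub> s0 x \<oplus>\<^bsub>G\<^esub> (b \<oplus>\<^bsub>G\<^esub> s0 y)"
  have a: "a \<in> Arr G" "\<alpha>\<^bsub>G\<^esub> a = x" "\<beta>\<^bsub>G\<^esub> a = y"
    using x y b by (simp_all add: a_def)
  \<comment> \<open>The boundary of this element is exactly that error term, moved to the right of
    \<open>b\<close>.\<close>
  have "s1 a \<triangleright> (\<ominus>\<^bsub>G\<^esub> s0 y) \<in> f2 ` Arr C"
    using a y f2 by simp
  then obtain d where d: "d \<in> Arr C" "f2 d = s1 a \<triangleright> (\<ominus>\<^bsub>G\<^esub> s0 y)"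
    unfolding image_iff by metis
  have "f0 (\<beta>\<^bsub>C\<^esub> d) = f0 y"
    using tgt_f2[OF d(1)] a y by (simp add: d(2))
  then have [simp]: "\<beta>\<^bsub>C\<^esub> d = y"
    using f0 d(1) y(1) by (meson bij_betw_def inj_onD tgt_C_closed)
  have "f1 a = s0 x \<oplus>\<^bsub>G\<^esub> (a \<oplus>\<^bsub>G\<^esub> (\<delta> (s1 a) \<oplus>\<^bsub>G\<^esub> \<ominus>\<^bsub>G\<^esub> s0 y))"
    using a by (simp add: f1_apply)
  also have "\<dots> = s0 x \<oplus>\<^bsub>G\<^esub> (a \<oplus>\<^bsub>G\<^esub> (\<ominus>\<^bsub>G\<^esub> s0 y \<oplus>\<^bsub>G\<^esub> \<delta> (f2 d)))"
    using a y d by simp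
  also have "\<dots> = b \<oplus>\<^bsub>G\<^esub> \<delta> (f2 d)"
    using x y b d(1) by (simp add: a_def)
  finally have "f1 a = b \<oplus>\<^bsub>G\<^esub> f1 (\<delta> d)"
    using d(1) by (simp add: bdry_f2)
  \<comment> \<open>The error is the image of \<open>\<delta> d\<close>, so subtracting
    \<open>\<delta> d\<close> from \<open>a\<close> removes it.\<close>
  then have "f1 (a \<oplus>\<^bsub>G\<^esub> \<ominus>\<^bsub>G\<^esub> \<delta> d) = b"
    using a b d(1) y by (simp add: f1_comp f1_neg)
  moreover have "a \<oplus>\<^bsub>G\<^esub> \<ominus>\<^bsub>G\<^esub> \<delta> d \<in> Arr G"
    using a d(1) by simp
  ultimately show ?thesis
    by blast
qed

text \<open>Both automorphism conditions include bijectivity of \<open>f0\<close>, which is what the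
  two preceding lemmas need besides \<open>f2\<close>.\<close>

lemma f1_Aut_if_f2_Aut: "(f0, f2) \<in> groupoid_Aut C \<Longrightarrow> (f0, f1) \<in> groupoid_Aut G"
  unfolding f1_Aut_iff f2_Aut_iff
  using inj_on_f1 surj_f1 f1_closed by (metis bij_betw_def image_subsetI subsetI subset_antisym)

end

section \<open>Products of two free derivations\<close>

locale two_free_derivations =
  s: free_derivation M s0 s1 + t: free_derivation M t0 t1
  for M :: "('x, 'g, 'c) crossed_module" and s0 s1 t0 t1
begin

lemma mult_eq:
  "FDer_mult M (s0, s1) (t0, t1) =
    (\<lambda>x\<in>Obj s.G. s0 (t.f0 x) \<oplus>\<^bsub>s.G\<^esub> t0 x,
     \<lambda>a\<in>Arr s.G. t1 a \<oplus>\<^bsub>s.C\<^esub> act M (s1 (t.f1 a)) (t0 (\<beta>\<^bsub>s.G\<^esub> a)))"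
  by (simp add: FDer_mult_def t.Delta_eq)

text \<open>These equations are the functoriality of \<open>\<Delta>\<close>, specialised to a product equal to the unit.\<close>

lemma
  assumes "FDer_mult M (s0, s1) (t0, t1) = FDer_one M"
  shows f0_f0: "x \<in> Obj s.G \<Longrightarrow> s.f0 (t.f0 x) = x"
    and f1_f1: "a \<in> Arr s.G \<Longrightarrow> s.f1 (t.f1 a) = a"
    and f2_f2: "c \<in> Arr s.C \<Longrightarrow> s.f2 (t.f2 c) = c"
proof -
  have one0: "s0 (t.f0 x) \<oplus>\<^bsub>s.G\<^esub> t0 x = \<e>\<^bsub>s.G\<^esub> x" if "x \<in> Obj s.G" for x
    using assms that by (auto simp: mult_eq FDer_one_def dest: fun_cong[where x = x])
  have one1: "t1 a \<oplus>\<^bsub>s.C\<^esub> act M (s1 (t.f1 a)) (t0 (\<beta>\<^bsub>s.G\<^esub> a)) = \<e>\<^bsub>s.C\<^esub> (\<beta>\<^bsub>s.G\<^esub> a)"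
    if "a \<in> Arr s.G" for a
    using assms that by (auto simp: mult_eq FDer_one_def dest: fun_cong[where x = a])
  show obj: "s.f0 (t.f0 x) = x" if "x \<in> Obj s.G" for x
    using that arg_cong[OF one0[of x], of "\<alpha>\<^bsub>s.G\<^esub>"] by simp
  \<comment> \<open>The unit equations are solved for \<open>s0\<close> and \<open>s1\<close> at
    images under \<open>\<Delta>(t)\<close>, turning the composites below into words in
    \<open>t0\<close> and \<open>t1\<close>.\<close>
  have s0: "s0 (t.f0 x) = \<ominus>\<^bsub>s.G\<^esub> t0 x" if "x \<in> Obj s.G" for x
    by (rule s.G.diff_eq_ident) (use that in \<open>simp_all add: obj one0\<close>)
  have s1: "s1 (t.f1 a) = (\<ominus>\<^bsub>s.C\<^esub> t1 a) \<triangleright> (\<ominus>\<^bsub>s.G\<^esub> t0 (\<beta>\<^bsub>s.G\<^esub> a))" if "a \<in> Arr s.G" for a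
  proof -
    have "\<ominus>\<^bsub>s.C\<^esub> t1 a = act M (s1 (t.f1 a)) (t0 (\<beta>\<^bsub>s.G\<^esub> a))"
      by (rule s.C.neg_unique) (use that in \<open>simp_all add: one1\<close>)
    then show ?thesis
      using that by simp
  qed
  show "s.f1 (t.f1 a) = a" if "a \<in> Arr s.G" for a
    \<comment> \<open>Two passes: \<open>t.f1 a\<close> must stay folded until \<open>s0\<close> and
      \<open>s1\<close> have been substituted. For \<open>f2\<close>, \<open>t.bdry_f2\<close> first
      exposes \<open>t.f1 (\<delta> c)\<close>.\<close>
    using that by (simp add: s.f1_apply[of "t.f1 a"] s0 s1) (simp add: t.f1_apply)
  show "s.f2 (t.f2 c) = c" if "c \<in> Arr s.C" for c
    using that by (simp add: s.f2_apply[of "t.f2 c"] t.bdry_f2 s0 s1) (simp add: t.f2_apply)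
qed

end

section \<open>Invertible derivations and automorphisms\<close>

context free_derivation
begin

lemma Aut_if_invertible:
  assumes "(s0, s1) \<in> FDer_star M"
  shows "(f0, f1) \<in> groupoid_Aut G" "(f0, f2) \<in> groupoid_Aut C"
proof -
  obtain t0 t1 where t: "(t0, t1) \<in> FDer M"
    and st: "FDer_mult M (s0, s1) (t0, t1) = FDer_one M"
    and ts: "FDer_mult M (t0, t1) (s0, s1) = FDer_one M"
    using assms by (auto simp: FDer_star_def Units_def FDer_monoid_def)
  interpret t: free_derivation M t0 t1
    by unfold_locales (rule t)
  \<comment> \<open>The two orders of the product supply the two one-sided inverses of each
    component.\<close>
  interpret st: two_free_derivations M s0 s1 t0 t1 ..
  interpret ts: two_free_derivations M t0 t1 s0 s1 ..
  have "bij_betw f0 (Obj G) (Obj G)"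
    by (rule bij_betw_byWitness[where f' = t.f0]) (auto simp: st.f0_f0[OF st] ts.f0_f0[OF ts])
  moreover have "bij_betw f1 (Arr G) (Arr G)"
    by (rule bij_betw_byWitness[where f' = t.f1]) (auto simp: st.f1_f1[OF st] ts.f1_f1[OF ts])
  moreover have "bij_betw f2 (Arr C) (Arr C)"
    by (rule bij_betw_byWitness[where f' = t.f2]) (auto simp: st.f2_f2[OF st] ts.f2_f2[OF ts])
  ultimately show "(f0, f1) \<in> groupoid_Aut G" "(f0, f2) \<in> groupoid_Aut C"
    by (simp_all add: f1_Aut_iff f2_Aut_iff)
qed

lemma invertible_if_f1_Aut:
  assumes "(f0, f1) \<in> groupoid_Aut G"
  shows "(s0, s1) \<in> FDer_star M"
proof -
  define h0 where "h0 = inv_into (Obj G) f0"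
  define h1 where "h1 = inv_into (Arr G) f1"
  have f0: "bij_betw f0 (Obj G) (Obj G)" and f1: "bij_betw f1 (Arr G) (Arr G)"
    using assms by (simp_all add: f1_Aut_iff)
  have h0 [simp]: "h0 x \<in> Obj G" "f0 (h0 x) = x" "h0 (f0 x) = x" if "x \<in> Obj G" for x
    using f0 that unfolding h0_def
    by (simp_all add: bij_betw_def inv_into_into f_inv_into_f)
  have h1 [simp]: "h1 a \<in> Arr G" "f1 (h1 a) = a" "h1 (f1 a) = a" if "a \<in> Arr G" for a
    using f1 that unfolding h1_def
    by (simp_all add: bij_betw_def inv_into_into f_inv_into_f)
  have h1_src [simp]: "\<alpha>\<^bsub>G\<^esub> (h1 a) = h0 (\<alpha>\<^bsub>G\<^esub> a)" if "a \<in> Arr G" for a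
    using that h0(3)[of "\<alpha>\<^bsub>G\<^esub> (h1 a)"] src_f1[of "h1 a"] by simp
  have h1_tgt [simp]: "\<beta>\<^bsub>G\<^esub> (h1 a) = h0 (\<beta>\<^bsub>G\<^esub> a)" if "a \<in> Arr G" for a
    using that h0(3)[of "\<beta>\<^bsub>G\<^esub> (h1 a)"] tgt_f1[of "h1 a"] by simp
  have h1_comp: "h1 (a \<oplus>\<^bsub>G\<^esub> b) = h1 a \<oplus>\<^bsub>G\<^esub> h1 b"
    if "a \<in> Arr G" "b \<in> Arr G" "\<beta>\<^bsub>G\<^esub> a = \<alpha>\<^bsub>G\<^esub> b" for a b
    using that h1(3)[of "h1 a \<oplus>\<^bsub>G\<^esub> h1 b"] by (simp add: f1_comp)
  \<comment> \<open>Both formulas are forced by \<open>s * t = 1\<close> once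
    \<open>\<Delta>(t)\<close> is required to have components \<open>h0\<close> and
    \<open>h1\<close>.\<close>
  define t0 where "t0 = (\<lambda>x\<in>Obj G. \<ominus>\<^bsub>G\<^esub> s0 (h0 x))"
  define t1 where "t1 = (\<lambda>a\<in>Arr G. \<ominus>\<^bsub>C\<^esub> (s1 (h1 a) \<triangleright> t0 (\<beta>\<^bsub>G\<^esub> a)))"
  have t0: "t0 x = \<ominus>\<^bsub>G\<^esub> s0 (h0 x)" if "x \<in> Obj G" for x
    using that by (simp add: t0_def)
  have t1: "t1 a = \<ominus>\<^bsub>C\<^esub> (s1 (h1 a) \<triangleright> (\<ominus>\<^bsub>G\<^esub> s0 (h0 (\<beta>\<^bsub>G\<^esub> a))))" if "a \<in> Arr G" for a
    using that by (simp add: t1_def t0)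
  \<comment> \<open>This is \<open>a = f1 (h1 a)\<close> spelled out, which expresses
    \<open>a\<close> through \<open>h1 a\<close>, where \<open>s1\<close> is evaluated.\<close>
  have a_eq: "a = s0 (h0 (\<alpha>\<^bsub>G\<^esub> a)) \<oplus>\<^bsub>G\<^esub> (h1 a \<oplus>\<^bsub>G\<^esub> (\<delta> (s1 (h1 a)) \<oplus>\<^bsub>G\<^esub> \<ominus>\<^bsub>G\<^esub> s0 (h0 (\<beta>\<^bsub>G\<^esub> a))))"
    if "a \<in> Arr G" for a
    using that f1_apply[of "h1 a"] by simp
  have t1_comp: "t1 (a \<oplus>\<^bsub>G\<^esub> b) = t1 a \<triangleright> b \<oplus>\<^bsub>C\<^esub> t1 b"
    if ab: "a \<in> Arr G" "b \<in> Arr G" "\<beta>\<^bsub>G\<^esub> a = \<alpha>\<^bsub>G\<^esub> b" for a b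
  proof -
    \<comment> \<open>Acting by the expanded \<open>b\<close> conjugates by
      \<open>s1 (h1 b)\<close>; adding \<open>t1 b\<close> cancels one conjugating factor and leaves
      the negative of the derivation law for \<open>s1\<close>.\<close>
    have "t1 a \<triangleright> b = t1 a \<triangleright> (s0 (h0 (\<alpha>\<^bsub>G\<^esub> b)) \<oplus>\<^bsub>G\<^esub>
        (h1 b \<oplus>\<^bsub>G\<^esub> (\<delta> (s1 (h1 b)) \<oplus>\<^bsub>G\<^esub> \<ominus>\<^bsub>G\<^esub> s0 (h0 (\<beta>\<^bsub>G\<^esub> b)))))"
      using a_eq[OF ab(2)] by simp
    then show ?thesis
      using ab by (simp add: t1 h1_comp)
  qed
  have t: "(t0, t1) \<in> FDer M"
    by (auto simp: FDer_def t1_comp) (auto simp: t0_def t1_def)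
  interpret t: free_derivation M t0 t1
    by unfold_locales (rule t)
  interpret st: two_free_derivations M s0 s1 t0 t1 ..
  interpret ts: two_free_derivations M t0 t1 s0 s1 ..
  have t_f0: "t.f0 x = h0 x" if "x \<in> Obj G" for x
    using that by (simp add: t.f0_apply t0)
  have t_f1: "t.f1 a = h1 a" if a: "a \<in> Arr G" for a
  proof -
    \<comment> \<open>Only the middle \<open>a\<close> is expanded; all terms in \<open>s0\<close>
      and \<open>s1\<close> then cancel against \<open>t0\<close> and \<open>t1\<close>.\<close>
    have "t.f1 a = t0 (\<alpha>\<^bsub>G\<^esub> a) \<oplus>\<^bsub>G\<^esub> ((s0 (h0 (\<alpha>\<^bsub>G\<^esub> a)) \<oplus>\<^bsub>G\<^esub>
        (h1 a \<oplus>\<^bsub>G\<^esub> (\<delta> (s1 (h1 a)) \<oplus>\<^bsub>G\<^esub> \<ominus>\<^bsub>G\<^esub> s0 (h0 (\<beta>\<^bsub>G\<^esub> a))))) \<oplus>\<^bsub>G\<^esub>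
        (\<delta> (t1 a) \<oplus>\<^bsub>G\<^esub> \<ominus>\<^bsub>G\<^esub> t0 (\<beta>\<^bsub>G\<^esub> a)))"
      using a a_eq[OF a] by (simp add: t.f1_apply)
    then show ?thesis
      using a by (simp add: t0 t1)
  qed
  \<comment> \<open>This product involves \<open>\<Delta>(t)\<close>, hence \<open>t_f0\<close> and
    \<open>t_f1\<close>; the opposite one involves \<open>f0\<close> and \<open>f1\<close>, which
    \<open>h0\<close> and \<open>h1\<close> undo.\<close>
  have "FDer_mult M (s0, s1) (t0, t1) = FDer_one M"
    by (auto simp: st.mult_eq FDer_one_def fun_eq_iff t_f0 t_f1 t0 t1)
  moreover have "FDer_mult M (t0, t1) (s0, s1) = FDer_one M"
    by (auto simp: ts.mult_eq FDer_one_def fun_eq_iff t0 t1)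
  ultimately show ?thesis
    using FDer t by (auto simp: FDer_star_def Units_def FDer_monoid_def)
qed

end

theorem theorem2p5:
  fixes M :: "('x, 'g, 'c) crossed_module"
    and s :: "('x \<Rightarrow> 'g) \<times> ('g \<Rightarrow> 'c)"
    and f0 :: "'x \<Rightarrow> 'x" and f1 :: "'g \<Rightarrow> 'g" and f2 :: "'c \<Rightarrow> 'c"
  assumes "crossed_module M"
    and "s \<in> FDer M"
    and "(f0, f1, f2) = Delta M s"
  shows "(s \<in> FDer_star M \<longleftrightarrow> (f0, f1) \<in> groupoid_Aut (Ggd M)) \<and>
         ((f0, f1) \<in> groupoid_Aut (Ggd M) \<longleftrightarrow> (f0, f2) \<in> groupoid_Aut (Cgd M))"
proof -
  obtain s0 s1 where s: "s = (s0, s1)"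
    by fastforce
  interpret D: free_derivation M s0 s1
    using assms(1,2) by (simp add: s free_derivation_def free_derivation_axioms_def)
  have "f0 = D.f0" "f1 = D.f1" "f2 = D.f2"
    using assms(3) by (simp_all add: s D.Delta_eq)
  \<comment> \<open>The implications used are (i) to (ii) and (iii), (ii) to (i), and (iii) to
    (ii).\<close>
  then show ?thesis
    using D.Aut_if_invertible D.invertible_if_f1_Aut D.f1_Aut_if_f2_Aut s by blast
qed

end
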